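(* Let $n\ge 1$, and let $A,B$ be finite vertex sets with $|A\cap B|\le n+1$. Let $\Omega$ be any finite set containing $A\cup B$, with chain groups and $\mathrm{Zvol}$ taken with respect to $\Omega$. Then for all integral $n$-cycles $X\in Z_n(A)$ and $Y\in Z_n(B)$, $$\mathrm{Zvol}(X+Y)=\mathrm{Zvol}(X)+\mathrm{Zvol}(Y).$$ Moreover, if $n\ge 2$, then for every taut filling $M$ of $X+Y$ there exist a taut filling $M_X$ of $X$ and a taut filling $M_Y$ of $Y$ such that $M=M_X+M_Y$.
   Context: For a finite set $\Omega$, $\Delta(\Omega)$ is the abstract simplicial complex of all subsets of $\Omega$, $C_k(\Omega)=C_k(\Delta(\Omega),\mathbf{Z})$ is the group of integral oriented simplicial $k$-chains, and $Z_k(\Omega)$ is the subgroup of $k$-cycles (kernel of the boundary $\partial$). For $A\subset\Omega$ we regard $C_k(A)\subset C_k(\Omega)$ and $Z_k(A)\subset Z_k(\Omega)$. The $L_1$-norm $|M|$ of a chain $M$ is the sum of the absolute values of its coefficients over unoriented simplices. A filling of an $n$-cycle $X$ is an $(n+1)$-chain $M\in C_{n+1}(\Omega)$ with $\partial M=X$. $\mathrm{Zvol}(X)$ is the minimum of $|M|$ over all fillings $M$ of $X$. A taut filling of $X$ is a filling $M$ of $X$ with $|M|=\mathrm{Zvol}(X)$. *)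

theory Defs
  imports "HOL-Library.Poly_Mapping" "HOL-Combinatorics.Permutations"
begin

text \<open>
  An oriented simplex of the full complex on a vertex set is represented by a list of distinct
  vertices. An integral oriented chain is a finitely supported integer-valued function on such
  lists that changes by the sign of the permutation when the vertices are reordered; its value at
  a list is the coefficient of the corresponding oriented simplex.
\<close>

definition chains :: "nat \<Rightarrow> 'a set \<Rightarrow> ('a list \<Rightarrow>\<^sub>0 int) set" where
  "chains k \<Omega> = {c.
     (\<forall>xs \<in> Poly_Mapping.keys c. length xs = k + 1 \<and> distinct xs \<and> set xs \<subseteq> \<Omega>) \<and>
     (\<forall>xs p. p permutes {..<length xs} \<longrightarrow>
        Poly_Mapping.lookup c (permute_list p xs) = sign p * Poly_Mapping.lookup c xs)}"

text \<open>
  The elementary chain of the oriented simplex with ordered vertices \<open>xs\<close> (distinct): coefficient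
  \<open>1\<close> on \<open>xs\<close>, and hence the sign of the permutation on every reordering of \<open>xs\<close>.
\<close>

definition oriented_simplex :: "'a list \<Rightarrow> ('a list \<Rightarrow>\<^sub>0 int)" where
  "oriented_simplex xs =
     (\<Sum>p | p permutes {..<length xs}. frag_cmul (sign p) (frag_of (permute_list p xs)))"

definition simplex_boundary :: "'a list \<Rightarrow> ('a list \<Rightarrow>\<^sub>0 int)" where
  "simplex_boundary xs =
     (\<Sum>i<length xs. frag_cmul ((-1) ^ i) (oriented_simplex (take i xs @ drop (Suc i) xs)))"

text \<open>
  The unoriented simplices occurring in a chain, and an arbitrary choice of an orientation of an
  unoriented simplex. For members of \<open>chains k \<Omega>\<close>, neither the boundary nor the norm below depends
  on this choice. Every chain is the sum of coefficient times elementary chain over its unoriented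
  simplices, so \<open>boundary\<close> is the linear extension of \<open>simplex_boundary\<close>.
\<close>

definition simplices :: "('a list \<Rightarrow>\<^sub>0 int) \<Rightarrow> 'a set set" where
  "simplices c = set ` Poly_Mapping.keys c"

definition orientation :: "'a set \<Rightarrow> 'a list" where
  "orientation s = (SOME xs. distinct xs \<and> set xs = s)"

definition boundary :: "('a list \<Rightarrow>\<^sub>0 int) \<Rightarrow> ('a list \<Rightarrow>\<^sub>0 int)" where
  "boundary c =
     (\<Sum>s \<in> simplices c. frag_cmul (Poly_Mapping.lookup c (orientation s))
                            (simplex_boundary (orientation s)))"

text \<open>
  The boundary of a vertex is the empty simplex (augmented convention), so \<open>cycles 0\<close> consists of
  the reduced 0-cycles; in positive dimensions there is no difference.
\<close>

definition cycles :: "nat \<Rightarrow> 'a set \<Rightarrow> ('a list \<Rightarrow>\<^sub>0 int) set" where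
  "cycles k \<Omega> = {c \<in> chains k \<Omega>. boundary c = 0}"

definition l1_norm :: "('a list \<Rightarrow>\<^sub>0 int) \<Rightarrow> nat" where
  "l1_norm c = (\<Sum>s \<in> simplices c. nat \<bar>Poly_Mapping.lookup c (orientation s)\<bar>)"

definition filling :: "'a set \<Rightarrow> nat \<Rightarrow> ('a list \<Rightarrow>\<^sub>0 int) \<Rightarrow> ('a list \<Rightarrow>\<^sub>0 int) \<Rightarrow> bool" where
  "filling \<Omega> n X M \<longleftrightarrow> M \<in> chains (n + 1) \<Omega> \<and> boundary M = X"

text \<open>
  The full complex on \<open>\<Omega>\<close> is acyclic, so for \<open>n \<ge> 1\<close> every cycle in \<open>cycles n \<Omega>\<close> has a filling and the
  minimum is attained.
\<close>

definition Zvol :: "'a set \<Rightarrow> nat \<Rightarrow> ('a list \<Rightarrow>\<^sub>0 int) \<Rightarrow> nat" where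
  "Zvol \<Omega> n X = (LEAST m. \<exists>M. filling \<Omega> n X M \<and> l1_norm M = m)"

definition taut_filling :: "'a set \<Rightarrow> nat \<Rightarrow> ('a list \<Rightarrow>\<^sub>0 int) \<Rightarrow> ('a list \<Rightarrow>\<^sub>0 int) \<Rightarrow> bool" where
  "taut_filling \<Omega> n X M \<longleftrightarrow> filling \<Omega> n X M \<and> l1_norm M = Zvol \<Omega> n X"

end

(*
  Let f collapse everything outside A to a vertex a of A \<inter> B, and let g collapse everything outside
  B to a vertex b of A \<inter> B. The image of Y under f is an n-cycle on at most n + 1 vertices, hence 0,
  so f maps a filling M of X + Y to a filling of X, and g maps it to a filling of Y. If a and b
  differ whenever A \<inter> B has n + 1 vertices, no (n+1)-simplex survives both collapses, so the two
  images together have norm at most |M|.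

  If M is taut, every simplex of M survives exactly one of the two collapses, for all admissible a
  and b. For n \<ge> 2 this forces a simplex to lie in A or in B, or else to be disjoint from A \<inter> B with
  at most one vertex outside A or at most one outside B. Let M1 be the part of M in A or of the
  third type relative to A, and M2 the rest. Then the boundary of M1 minus X equals Y minus the
  boundary of M2, which is a cycle supported on A \<inter> B, hence 0.
*)
theory Submission
  imports Defs "HOL-Combinatorics.Multiset_Permutations"
begin

section \<open>Chains as alternating functions on lists\<close>

abbreviation coeff :: "('a list \<Rightarrow>\<^sub>0 int) \<Rightarrow> 'a list \<Rightarrow> int" where
  "coeff \<equiv> Poly_Mapping.lookup"

text \<open>Only adjacent swaps are demanded. They generate all permutations, so this encodes the
  sign rule of \<open>chains\<close> in a form that can be checked without permutations.\<close>

definition alternating :: "('a list \<Rightarrow> int) \<Rightarrow> bool" where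
  "alternating F \<longleftrightarrow> (\<forall>as x y bs. F (as @ x # y # bs) = - F (as @ y # x # bs))"

lemma alternatingD: "alternating F \<Longrightarrow> F (as @ x # y # bs) = - F (as @ y # x # bs)"
  unfolding alternating_def by blast

lemma alternatingI: "(\<And>as x y bs. F (as @ x # y # bs) = - F (as @ y # x # bs)) \<Longrightarrow> alternating F"
  unfolding alternating_def by blast

lemma alternating_Cons:
  assumes "alternating F"
  shows "alternating (\<lambda>ys. F (v # ys))"
proof (rule alternatingI)
  show "F (v # as @ x # y # bs) = - F (v # as @ y # x # bs)" for as x y bs
    using alternatingD[OF assms, of "v # as" x y bs] by simp
qed

lemma alternating_add:
  assumes "alternating F" "alternating G"
  shows "alternating (\<lambda>ys. F ys + G ys)"
proof (rule alternatingI)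
  show "F (as @ x # y # bs) + G (as @ x # y # bs) = - (F (as @ y # x # bs) + G (as @ y # x # bs))" for as x y bs
    using alternatingD[OF assms(1), of as x y bs] alternatingD[OF assms(2), of as x y bs] by simp
qed

lemma alternating_diff:
  assumes "alternating F" "alternating G"
  shows "alternating (\<lambda>ys. F ys - G ys)"
proof (rule alternatingI)
  show "F (as @ x # y # bs) - G (as @ x # y # bs) = - (F (as @ y # x # bs) - G (as @ y # x # bs))" for as x y bs
    using alternatingD[OF assms(1), of as x y bs] alternatingD[OF assms(2), of as x y bs] by simp
qed

lemma alternating_move:
  assumes "alternating F"
  shows "F (as @ x # ms @ bs) = (-1) ^ length ms * F (as @ ms @ x # bs)"
proof (induction ms arbitrary: as)
  case (Cons m ms)
  have "F (as @ x # m # ms @ bs) = - F ((as @ [m]) @ x # ms @ bs)"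
    using alternatingD[OF assms, of as x m "ms @ bs"] by simp
  also have "\<dots> = - ((-1) ^ length ms * F ((as @ [m]) @ ms @ x # bs))"
    by (subst Cons.IH) simp
  finally show ?case by simp
qed simp

text \<open>Moving \<open>x\<close> and moving \<open>y\<close> past \<open>ms\<close> cost the same
  sign, so only the one swap of neighbours counts.\<close>

lemma alternating_exchange:
  assumes "alternating F"
  shows "F (as @ x # ms @ y # bs) = - F (as @ y # ms @ x # bs)"
proof -
  have "F (as @ x # ms @ y # bs) = (-1) ^ length ms * F ((as @ ms) @ x # y # bs)"
    using alternating_move[OF assms, of as x ms "y # bs"] by simp
  also have "\<dots> = - ((-1) ^ length ms * F ((as @ ms) @ y # x # bs))"
    using alternatingD[OF assms, of "as @ ms" x y bs] by simp
  finally show ?thesis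
    using alternating_move[OF assms, of as y ms "x # bs"] by simp
qed

text \<open>Exchanging two equal entries fixes the list but negates the value, and an integer equal
  to its negative is 0.\<close>

lemma alternating_not_distinct:
  assumes "alternating F" "\<not> distinct xs"
  shows "F xs = 0"
proof -
  obtain as ms bs y where "xs = as @ [y] @ ms @ [y] @ bs"
    using assms(2) not_distinct_decomp by blast
  then show ?thesis using alternating_exchange[OF assms(1), of as y ms y bs] by simp
qed

lemma permute_list_transpose:
  assumes "a < length xs" "b < length xs"
  shows "permute_list (Transposition.transpose a b) xs = xs[a := xs ! b, b := xs ! a]"
proof -
  have p: "Transposition.transpose a b permutes {..<length xs}"
    using assms by (intro permutes_swap_id) auto
  show ?thesis
    by (rule nth_equalityI)
       (use assms in \<open>auto simp: permute_list_nth[OF p] nth_list_update Transposition.transpose_def\<close>)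
qed

lemma alternating_transpose:
  assumes F: "alternating F" and "a \<noteq> b" "a < length xs" "b < length xs"
  shows "F (permute_list (Transposition.transpose a b) xs) = - F xs"
  using assms(2-)
proof (induction a b rule: linorder_wlog)
  case (le a b)
  \<comment> \<open>The list is cut at positions \<open>a\<close> and \<open>b\<close>; the
    transposition then exchanges the entries on either side of the middle block
    \<open>ms\<close>.\<close>
  define as ms bs where "as = take a xs" and "ms = drop (Suc a) (take b xs)" and "bs = drop (Suc b) xs"
  have "take b xs = as @ xs ! a # ms"
    using le id_take_nth_drop[of a "take b xs"] by (simp add: as_def ms_def min_def)
  then have xs: "xs = as @ xs ! a # ms @ xs ! b # bs"
    using le id_take_nth_drop[of b xs] by (simp add: bs_def)
  obtain x y where xy: "x = xs ! a" "y = xs ! b" by simp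
  have len: "length as = a" "length ms = b - Suc a"
    using le by (auto simp: as_def ms_def min_def)
  have "xs[a := y, b := x] = as @ y # ms @ x # bs"
    apply (subst xs)
    using le len by (auto simp: list_update_append xy[symmetric] not_less split: nat.split)
  then show ?case
    using alternating_exchange[OF F, of as y ms x bs] xs permute_list_transpose le xy by metis
next
  case (sym a b)
  then show ?case by (simp add: transpose_commute)
qed

text \<open>Induction over a factorization of \<open>p\<close> into transpositions, each of which
  contributes a factor -1.\<close>

lemma alternating_permute:
  assumes F: "alternating F" and p: "p permutes {..<length xs}"
  shows "F (permute_list p xs) = sign p * F xs"
  using finite_lessThan p
proof (induction p rule: permutes_rev_induct)
  case (swap a b p)
  have t: "Transposition.transpose a b permutes {..<length xs}"
    using swap by (intro permutes_swap_id) auto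
  have "F (permute_list (p \<circ> Transposition.transpose a b) xs) = - F (permute_list p xs)"
    unfolding permute_list_compose[OF t] using swap.hyps by (intro alternating_transpose[OF F]) auto
  moreover have "sign (p \<circ> Transposition.transpose a b) = - sign p"
    using permutes_imp_permutation[OF finite_lessThan swap.hyps(4)] swap.hyps(3)
    by (simp only: sign_compose permutation_swap_id sign_swap_id if_False mult_minus1_right)
  ultimately show ?case by (simp only: swap.IH mult_minus_left)
qed simp

lemma alternating_abs_eq:
  assumes F: "alternating F" and "distinct xs" "distinct ys" "set xs = set ys"
  shows "\<bar>F xs\<bar> = \<bar>F ys\<bar>"
proof -
  have "mset xs = mset ys" using assms set_eq_iff_mset_eq_distinct by blast
  then obtain p where "p permutes {..<length ys}" "permute_list p ys = xs"
    by (rule mset_eq_permutation)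
  then show ?thesis using alternating_permute[OF F] by (metis abs_mult abs_sign mult_1)
qed

section \<open>Chains characterised by their coefficient functions\<close>

lemma chains_altdef:
  "c \<in> chains k \<Omega> \<longleftrightarrow> alternating (coeff c) \<and>
     (\<forall>xs. coeff c xs \<noteq> 0 \<longrightarrow> length xs = k + 1 \<and> set xs \<subseteq> \<Omega>)"
proof
  assume c: "c \<in> chains k \<Omega>"
  have "coeff c (as @ x # y # bs) = - coeff c (as @ y # x # bs)" for as x y bs
  proof (cases "x = y")
    \<comment> \<open>For \<open>x = y\<close> the sign rule would have to give 0; it does because
      lists in the support of a chain are distinct.\<close>
    case True
    then have "as @ x # y # bs \<notin> Poly_Mapping.keys c" using c by (auto simp: chains_def)
    then show ?thesis using True by (simp add: in_keys_iff)
  next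
    case False
    define xs where "xs = as @ x # y # bs"
    let ?t = "Transposition.transpose (length as) (Suc (length as))"
    have "?t permutes {..<length xs}"
      by (intro permutes_swap_id) (auto simp: xs_def)
    then have "coeff c (permute_list ?t xs) = - coeff c xs"
      using c by (auto simp: chains_def sign_swap_id)
    moreover have "permute_list ?t xs = as @ y # x # bs"
      by (subst permute_list_transpose) (auto simp: xs_def list_update_append nth_append)
    ultimately show ?thesis by (simp add: xs_def)
  qed
  then have "alternating (coeff c)" by (rule alternatingI)
  moreover have "\<forall>xs. coeff c xs \<noteq> 0 \<longrightarrow> length xs = k + 1 \<and> set xs \<subseteq> \<Omega>"
    using c by (simp add: chains_def in_keys_iff)
  ultimately show "alternating (coeff c) \<and> (\<forall>xs. coeff c xs \<noteq> 0 \<longrightarrow> length xs = k + 1 \<and> set xs \<subseteq> \<Omega>)" ..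
next
  assume a: "alternating (coeff c) \<and>
     (\<forall>xs. coeff c xs \<noteq> 0 \<longrightarrow> length xs = k + 1 \<and> set xs \<subseteq> \<Omega>)"
  then have "distinct xs" if "coeff c xs \<noteq> 0" for xs
    using alternating_not_distinct that by blast
  with a show "c \<in> chains k \<Omega>"
    by (simp add: chains_def in_keys_iff alternating_permute)
qed

lemma chains_alternating: "c \<in> chains k \<Omega> \<Longrightarrow> alternating (coeff c)"
  and chains_length: "c \<in> chains k \<Omega> \<Longrightarrow> coeff c xs \<noteq> 0 \<Longrightarrow> length xs = k + 1"
  and chains_set: "c \<in> chains k \<Omega> \<Longrightarrow> coeff c xs \<noteq> 0 \<Longrightarrow> set xs \<subseteq> \<Omega>"
  by (simp_all add: chains_altdef)

lemma chains_distinct: "c \<in> chains k \<Omega> \<Longrightarrow> coeff c xs \<noteq> 0 \<Longrightarrow> distinct xs"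
  using alternating_not_distinct chains_alternating by blast

lemma chains_mono: "c \<in> chains k A \<Longrightarrow> A \<subseteq> \<Omega> \<Longrightarrow> c \<in> chains k \<Omega>"
  unfolding chains_altdef by blast

lemma chains_add:
  assumes "c \<in> chains k \<Omega>" "d \<in> chains k \<Omega>"
  shows "c + d \<in> chains k \<Omega>"
proof -
  have "coeff (c + d) = (\<lambda>xs. coeff c xs + coeff d xs)" by (simp add: fun_eq_iff lookup_add)
  moreover have "coeff c xs + coeff d xs \<noteq> 0 \<Longrightarrow> coeff c xs \<noteq> 0 \<or> coeff d xs \<noteq> 0" for xs by auto
  ultimately show ?thesis using assms unfolding chains_altdef by (metis alternating_add)
qed

text \<open>A finite \<open>\<Omega>\<close> carries finitely many lists of a given length, so such
  an \<open>F\<close> has finite support. New chains are built through their coefficient functions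
  in this way.\<close>

lemma ex_chain:
  fixes F :: "'a list \<Rightarrow> int"
  assumes "finite \<Omega>" "alternating F" "\<And>xs. F xs \<noteq> 0 \<Longrightarrow> length xs = k + 1 \<and> set xs \<subseteq> \<Omega>"
  obtains c where "c \<in> chains k \<Omega>" "coeff c = F"
proof -
  have "{xs. F xs \<noteq> 0} \<subseteq> {xs. set xs \<subseteq> \<Omega> \<and> length xs = k + 1}"
    using assms(3) by auto
  then have "finite {xs. F xs \<noteq> 0}"
    using finite_lists_length_eq[OF assms(1)] finite_subset by blast
  then have "coeff (Abs_poly_mapping F) = F" by simp
  then show thesis using that[of "Abs_poly_mapping F"] assms by (simp add: chains_altdef)
qed

lemma orientation:
  assumes "finite s"
  shows "distinct (orientation s)" "set (orientation s) = s"
proof -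
  have "distinct (orientation s) \<and> set (orientation s) = s"
    unfolding orientation_def
    using finite_distinct_list[OF assms] by (intro someI_ex[of "\<lambda>xs. distinct xs \<and> set xs = s"]) blast
  then show "distinct (orientation s)" "set (orientation s) = s" by auto
qed

section \<open>The boundary in coordinates\<close>

text \<open>The factor \<open>F xs\<close> absorbs the sign: if \<open>p\<close> takes
  \<open>xs\<close> to \<open>ys\<close>, then \<open>F xs * sign p\<close> is \<open>F ys\<close>,
  so no permutation remains on the right.\<close>

lemma lookup_oriented_simplex:
  assumes F: "alternating F" and xs: "distinct xs"
  shows "F xs * coeff (oriented_simplex xs) ys = (if set xs = set ys \<and> distinct ys then F ys else 0)"
proof -
  let ?P = "{p. p permutes {..<length xs}}"
  have "F xs * coeff (oriented_simplex xs) ys =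
      (\<Sum>p\<in>?P. F xs * (sign p * (if ys = permute_list p xs then 1 else 0)))"
    by (simp add: oriented_simplex_def lookup_sum sum_distrib_left)
  also have "\<dots> = (\<Sum>p\<in>?P. if ys = permute_list p xs then F ys else 0)"
  proof (rule sum.cong[OF refl])
    fix p assume "p \<in> ?P"
    then show "F xs * (sign p * (if ys = permute_list p xs then 1 else 0)) = (if ys = permute_list p xs then F ys else 0)"
      using alternating_permute[OF F, of p xs] by simp
  qed
  also have "\<dots> = (if set xs = set ys \<and> distinct ys then F ys else 0)"
  proof (cases "set xs = set ys \<and> distinct ys")
    case True
    then have "mset ys = mset xs" using xs set_eq_iff_mset_eq_distinct by blast
    then obtain q where q: "q permutes {..<length xs}" "permute_list q xs = ys"
      by (rule mset_eq_permutation)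
    \<comment> \<open>As \<open>xs\<close> is distinct, a single permutation takes it to
      \<open>ys\<close>, and the sum has exactly one nonzero term.\<close>
    have uniq: "p = q" if "p permutes {..<length xs}" "permute_list p xs = ys" for p
    proof
      fix i
      show "p i = q i"
      proof (cases "i < length xs")
        case True
        then have "xs ! p i = xs ! q i"
          using permute_list_nth[OF that(1) True] permute_list_nth[OF q(1) True] that(2) q(2) by simp
        moreover have "p i < length xs" "q i < length xs"
          using True permutes_in_image[OF that(1)] permutes_in_image[OF q(1)] by auto
        ultimately show ?thesis using xs nth_eq_iff_index_eq by blast
      qed (use permutes_not_in[OF that(1)] permutes_not_in[OF q(1)] in simp)
    qed
    have "ys = permute_list p xs \<longleftrightarrow> p = q" if "p \<in> ?P" for p
      using uniq[of p] that q(2) by blast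
    then have "(\<Sum>p\<in>?P. if ys = permute_list p xs then F ys else 0) = (\<Sum>p\<in>?P. if p = q then F ys else 0)"
      by (intro sum.cong refl if_cong) simp_all
    also have "\<dots> = F ys" using q by (simp add: finite_permutations)
    finally show ?thesis using True by simp
  next
    case False
    have "ys \<noteq> permute_list p xs" if "p \<in> ?P" for p
      using that False xs by auto
    then show ?thesis using False by (simp only: if_False sum.neutral_const cong: sum.cong)
  qed
  finally show ?thesis .
qed

text \<open>For an alternating \<open>F\<close>, this is the coefficient of \<open>ys\<close> in the boundary: every simplex
  containing \<open>ys\<close> is oriented so that the new vertex comes first, which makes all signs positive.\<close>

definition bd :: "'a set \<Rightarrow> ('a list \<Rightarrow> int) \<Rightarrow> 'a list \<Rightarrow> int" where
  "bd \<Omega> F ys = (\<Sum>v\<in>\<Omega>. F (v # ys))"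

text \<open>The sign \<open>(-1) ^ i\<close> is exactly the cost of moving vertex number
  \<open>i\<close> to the front, so it disappears once that vertex is written first.\<close>

lemma lookup_simplex_boundary:
  assumes F: "alternating F" and xs: "distinct xs"
  shows "F xs * coeff (simplex_boundary xs) ys =
    (\<Sum>v\<in>set xs. if set xs - {v} = set ys \<and> distinct ys then F (v # ys) else 0)"
proof -
  have "F xs * ((-1) ^ i * coeff (oriented_simplex (take i xs @ drop (Suc i) xs)) ys) =
      (if set xs - {xs ! i} = set ys \<and> distinct ys then F (xs ! i # ys) else 0)" if i: "i < length xs" for i
  proof -
    let ?zs = "take i xs @ drop (Suc i) xs"
    have dec: "xs = take i xs @ xs ! i # drop (Suc i) xs" using i by (rule id_take_nth_drop)
    have zs: "distinct ?zs" "set ?zs = set xs - {xs ! i}"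
    proof -
      have "distinct (take i xs @ xs ! i # drop (Suc i) xs)" using dec xs by simp
      moreover have "set xs = set (take i xs @ xs ! i # drop (Suc i) xs)" using dec by simp
      ultimately show "distinct ?zs" "set ?zs = set xs - {xs ! i}" by auto
    qed
    have "F (xs ! i # ?zs) = (-1) ^ i * F (take i xs @ xs ! i # drop (Suc i) xs)"
      using alternating_move[OF F, of "[]" "xs ! i" "take i xs" "drop (Suc i) xs"] i by (simp add: min_def)
    then have "F (xs ! i # ?zs) = (-1) ^ i * F xs" using dec by simp
    then show ?thesis
      using lookup_oriented_simplex[OF alternating_Cons[OF F] zs(1), of "xs ! i" ys] unfolding zs(2)
      by (simp add: mult_ac)
  qed
  then have "F xs * coeff (simplex_boundary xs) ys =
      (\<Sum>i<length xs. if set xs - {xs ! i} = set ys \<and> distinct ys then F (xs ! i # ys) else 0)"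
    by (simp add: simplex_boundary_def lookup_sum sum_distrib_left)
  also have "\<dots> = (\<Sum>v\<in>set xs. if set xs - {v} = set ys \<and> distinct ys then F (v # ys) else 0)"
    using xs bij_betw_nth[OF xs refl refl] by (intro sum.reindex_bij_betw) (simp add: atLeast0LessThan)
  finally show ?thesis .
qed

lemma simplices_chains:
  assumes "c \<in> chains k \<Omega>" "s \<in> simplices c"
  shows "finite s" "s \<subseteq> \<Omega>" "card s = k + 1"
proof -
  obtain xs where "s = set xs" "coeff c xs \<noteq> 0"
    using assms(2) by (auto simp: simplices_def in_keys_iff)
  then show "finite s" "s \<subseteq> \<Omega>" "card s = k + 1"
    using chains_set[OF assms(1)] chains_length[OF assms(1)] chains_distinct[OF assms(1)]
    by (auto simp: distinct_card)
qed

lemma simplices_chains_iff: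
  assumes "c \<in> chains k \<Omega>" "distinct xs"
  shows "set xs \<in> simplices c \<longleftrightarrow> coeff c xs \<noteq> 0"
proof
  assume "set xs \<in> simplices c"
  then obtain ys where "set ys = set xs" "coeff c ys \<noteq> 0"
    by (auto simp: simplices_def in_keys_iff)
  then show "coeff c xs \<noteq> 0"
    using alternating_abs_eq[OF chains_alternating[OF assms(1)], of xs ys] assms chains_distinct
    by fastforce
qed (auto simp: simplices_def in_keys_iff)

lemma lookup_boundary:
  assumes "finite \<Omega>" and c: "c \<in> chains k \<Omega>"
  shows "coeff (boundary c) = bd \<Omega> (coeff c)"
proof
  fix ys
  note alt = chains_alternating[OF c]
  \<comment> \<open>The condition \<open>v \<in> s\<close> lets \<open>v\<close> range over all of
    \<open>\<Omega>\<close>, a set independent of \<open>s\<close>, so that the two sums can be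
    interchanged.\<close>
  let ?g = "\<lambda>s v. if v \<in> s \<and> s - {v} = set ys \<and> distinct ys then coeff c (v # ys) else 0"
  have fin: "finite (simplices c)" by (simp add: simplices_def)
  have "coeff (boundary c) ys =
      (\<Sum>s\<in>simplices c. coeff c (orientation s) * coeff (simplex_boundary (orientation s)) ys)"
    by (simp add: boundary_def lookup_sum)
  also have "\<dots> = (\<Sum>s\<in>simplices c. \<Sum>v\<in>\<Omega>. ?g s v)"
  proof (rule sum.cong[OF refl])
    fix s assume "s \<in> simplices c"
    note s = simplices_chains[OF c this]
    have "coeff c (orientation s) * coeff (simplex_boundary (orientation s)) ys =
        (\<Sum>v\<in>s. if s - {v} = set ys \<and> distinct ys then coeff c (v # ys) else 0)"
      using lookup_simplex_boundary[OF alt orientation(1)[OF s(1)], of ys]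
      by (simp add: orientation(2)[OF s(1)])
    also have "\<dots> = (\<Sum>v\<in>\<Omega>. ?g s v)"
      using s assms(1) by (intro sum.mono_neutral_cong_left) auto
    finally show "coeff c (orientation s) * coeff (simplex_boundary (orientation s)) ys = (\<Sum>v\<in>\<Omega>. ?g s v)" .
  qed
  also have "\<dots> = (\<Sum>v\<in>\<Omega>. \<Sum>s\<in>simplices c. ?g s v)" by (rule sum.swap)
  also have "\<dots> = (\<Sum>v\<in>\<Omega>. coeff c (v # ys))"
  proof (rule sum.cong[OF refl])
    fix v assume v: "v \<in> \<Omega>"
    \<comment> \<open>For fixed \<open>v\<close> and \<open>ys\<close>, the only simplex that can
      contribute is the one with vertex set \<open>set (v # ys)\<close>.\<close>
    show "(\<Sum>s\<in>simplices c. ?g s v) = coeff c (v # ys)"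
    proof (cases "coeff c (v # ys) = 0")
      case True
      then show ?thesis by (intro trans[OF sum.neutral]) auto
    next
      case False
      then have d: "distinct (v # ys)" using chains_distinct[OF c] by blast
      then have "set (v # ys) \<in> simplices c" using simplices_chains_iff[OF c d] False by blast
      moreover have "?g s v = (if s = set (v # ys) then coeff c (v # ys) else 0)" for s
        using d by auto
      ultimately show ?thesis by (simp only: sum.delta[OF fin] if_True)
    qed
  qed
  finally show "coeff (boundary c) ys = bd \<Omega> (coeff c) ys" by (simp add: bd_def)
qed

abbreviation words :: "nat \<Rightarrow> 'a set \<Rightarrow> 'a list set" where
  "words k \<Omega> \<equiv> {xs. set xs \<subseteq> \<Omega> \<and> length xs = k}"

text \<open>An unoriented simplex has \<open>fact (k + 1)\<close> orderings, all with the same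
  absolute coefficient. Norms can thus be compared word by word, without choosing
  orientations.\<close>

lemma l1_norm_words:
  assumes "finite \<Omega>" and c: "c \<in> chains k \<Omega>"
  shows "fact (k + 1) * int (l1_norm c) = (\<Sum>xs\<in>words (k + 1) \<Omega>. \<bar>coeff c xs\<bar>)"
proof -
  note alt = chains_alternating[OF c]
  have "(\<Sum>xs\<in>words (k + 1) \<Omega>. \<bar>coeff c xs\<bar>) = (\<Sum>xs\<in>Poly_Mapping.keys c. \<bar>coeff c xs\<bar>)"
    using chains_set[OF c] chains_length[OF c] finite_lists_length_eq[OF assms(1), of "k + 1"]
    by (intro sum.mono_neutral_right) (auto simp: in_keys_iff)
  also have "\<dots> = (\<Sum>s\<in>simplices c. \<Sum>xs\<in>{xs \<in> Poly_Mapping.keys c. set xs = s}. \<bar>coeff c xs\<bar>)"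
    by (rule sum.group[symmetric]) (auto simp: simplices_def)
  also have "\<dots> = (\<Sum>s\<in>simplices c. fact (k + 1) * \<bar>coeff c (orientation s)\<bar>)"
  proof (rule sum.cong[OF refl])
    fix s assume s: "s \<in> simplices c"
    note s' = simplices_chains[OF c this] and o = orientation[OF simplices_chains(1)[OF c this]]
    have eq: "{xs \<in> Poly_Mapping.keys c. set xs = s} = permutations_of_set s"
      using chains_distinct[OF c] simplices_chains_iff[OF c] s
      by (auto simp: permutations_of_set_def in_keys_iff)
    have "(\<Sum>xs\<in>permutations_of_set s. \<bar>coeff c xs\<bar>) = (\<Sum>xs\<in>permutations_of_set s. \<bar>coeff c (orientation s)\<bar>)"
      using o by (intro sum.cong refl alternating_abs_eq[OF alt]) (auto simp: permutations_of_set_def)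
    also have "\<dots> = fact (k + 1) * \<bar>coeff c (orientation s)\<bar>"
      using s' by (simp del: fact_Suc)
    finally show "(\<Sum>xs\<in>{xs \<in> Poly_Mapping.keys c. set xs = s}. \<bar>coeff c xs\<bar>) = fact (k + 1) * \<bar>coeff c (orientation s)\<bar>"
      by (simp only: eq)
  qed
  finally show ?thesis by (simp add: l1_norm_def sum_distrib_left)
qed

lemma bd_diff: "bd \<Omega> (\<lambda>xs. F xs - G xs) ys = bd \<Omega> F ys - bd \<Omega> G ys"
  by (simp add: bd_def sum_subtractf)

lemma alternating_bd:
  assumes "alternating F"
  shows "alternating (bd \<Omega> F)"
proof (rule alternatingI)
  fix as x y bs
  have "F (v # as @ x # y # bs) = - F (v # as @ y # x # bs)" for v
    using alternatingD[OF assms, of "v # as" x y bs] by simp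
  then show "bd \<Omega> F (as @ x # y # bs) = - bd \<Omega> F (as @ y # x # bs)"
    unfolding bd_def sum_negf[symmetric] by (rule sum.cong[OF refl])
qed

text \<open>Swapping the two added vertices changes the sign, while the double sum is symmetric in
  them; hence it equals its own negative.\<close>

lemma bd_bd:
  assumes "alternating F"
  shows "bd \<Omega> (bd \<Omega> F) ys = 0"
proof -
  have "bd \<Omega> (bd \<Omega> F) ys = (\<Sum>v\<in>\<Omega>. \<Sum>w\<in>\<Omega>. - F (v # w # ys))"
    unfolding bd_def using alternatingD[OF assms, of "[]"] by (intro sum.cong refl) (metis append_Nil)
  also have "\<dots> = - bd \<Omega> (bd \<Omega> F) ys"
    unfolding bd_def by (subst sum.swap) (simp only: sum_negf)
  finally show ?thesis by simp
qed

text \<open>The only candidate for an \<open>n\<close>-simplex on \<open>C\<close> is \<open>C\<close> itself, and the boundary of a nonzero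
  multiple of it does not vanish.\<close>

lemma cycle_few_vertices:
  assumes "finite \<Omega>" "C \<subseteq> \<Omega>" "card C \<le> n + 1" and F: "alternating F"
    and supp: "\<And>xs. F xs \<noteq> 0 \<Longrightarrow> length xs = n + 1 \<and> set xs \<subseteq> C"
    and bd: "\<And>ys. bd \<Omega> F ys = 0"
  shows "F xs = 0"
proof (rule ccontr)
  assume nz: "F xs \<noteq> 0"
  have fin: "finite C" using assms(1,2) finite_subset by blast
  have full: "distinct zs" "set zs = C" if "F zs \<noteq> 0" for zs
  proof -
    show d: "distinct zs" using that alternating_not_distinct[OF F] by blast
    have "length zs = n + 1" "set zs \<subseteq> C" using supp[OF that] by auto
    then show "set zs = C"
      using distinct_card[OF d] fin assms(3) by (intro card_seteq) auto
  qed
  obtain v ys where xs: "xs = v # ys" using supp[OF nz] by (cases xs) auto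
  \<comment> \<open>A list in the support exhausts \<open>C\<close> without repetition, so
    \<open>v\<close> is the only vertex that completes \<open>ys\<close>.\<close>
  have "F (w # ys) = (if w = v then F xs else 0)" for w
    using full[of "w # ys"] full[of xs] nz by (auto simp: xs)
  then have "bd \<Omega> F ys = (\<Sum>w\<in>\<Omega>. if w = v then F xs else 0)"
    unfolding bd_def by (intro sum.cong) auto
  also have "\<dots> = F xs"
    using full(2)[OF nz] assms(1,2) by (subst sum.delta) (auto simp: xs)
  finally show False using bd nz by simp
qed

section \<open>Cones and simplicial maps\<close>

text \<open>Sum of \<open>F\<close> over all ways to delete one occurrence of \<open>p\<close>, with
  sign \<open>(-1) ^ i\<close> for a deletion at position \<open>i\<close>: the coefficients of the
  cone with apex \<open>p\<close>.\<close>

fun cone :: "'a \<Rightarrow> ('a list \<Rightarrow> int) \<Rightarrow> 'a list \<Rightarrow> int" where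
  "cone p F [] = 0"
| "cone p F (v # ys) = (if v = p then F ys else 0) - cone p (\<lambda>zs. F (v # zs)) ys"

lemma cone_cong: "(\<And>zs. F zs = G zs) \<Longrightarrow> cone p F ys = cone p G ys"
  by (rule arg_cong[of F G "\<lambda>H. cone p H ys"]) auto

lemma cone_minus: "cone p (\<lambda>zs. - F zs) ys = - cone p F ys"
  by (induction ys arbitrary: F) auto

lemma cone_zero: "cone p (\<lambda>zs. 0) ys = 0"
  by (induction ys) auto

lemma cone_sum: "cone p (\<lambda>zs. \<Sum>v\<in>S. F v zs) ys = (\<Sum>v\<in>S. cone p (F v) ys)"
  by (induction ys arbitrary: F) (auto simp: sum_subtractf)

lemma cone_support:
  assumes "cone p F ys \<noteq> 0"
  shows "\<exists>zs. F zs \<noteq> 0 \<and> length ys = Suc (length zs) \<and> set ys = insert p (set zs)"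
  using assms
proof (induction ys arbitrary: F)
  case (Cons v ys)
  show ?case
  proof (cases "v = p \<and> F ys \<noteq> 0")
    case False
    then have "cone p (\<lambda>zs. F (v # zs)) ys \<noteq> 0" using Cons.prems by (auto split: if_splits)
    from Cons.IH[OF this] obtain zs where "F (v # zs) \<noteq> 0" "length ys = Suc (length zs)"
      "set ys = insert p (set zs)" by blast
    then show ?thesis by (intro exI[of _ "v # zs"]) auto
  qed auto
qed simp

lemma alternating_cone:
  assumes "alternating F"
  shows "alternating (cone p F)"
proof -
  have "cone p F (as @ x # y # bs) = - cone p F (as @ y # x # bs)" for as x y bs
    using assms
  proof (induction as arbitrary: F)
    case Nil
    \<comment> \<open>Deleting \<open>x\<close> and deleting \<open>y\<close> give two terms that
      trade places under the swap with opposite signs; only this remaining term needs the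
      alternation of \<open>F\<close>.\<close>
    have "cone p (\<lambda>zs. F (x # y # zs)) bs = cone p (\<lambda>zs. - F (y # x # zs)) bs"
      using alternatingD[OF Nil, of "[]"] by (intro cone_cong) (metis append_Nil)
    then show ?case by (simp add: cone_minus)
  next
    case (Cons a as)
    have "cone p (\<lambda>zs. F (a # zs)) (as @ x # y # bs) = - cone p (\<lambda>zs. F (a # zs)) (as @ y # x # bs)"
      using alternating_Cons[OF Cons.prems] by (rule Cons.IH)
    then show ?case using alternatingD[OF Cons.prems, of as x y bs] by simp
  qed
  then show ?thesis by (rule alternatingI)
qed

text \<open>Coning is a contracting homotopy: putting \<open>p\<close> in front returns
  \<open>F ys\<close>, and the other terms regroup into minus the cone of
  \<open>bd \<Omega> F\<close>, which is 0.\<close>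

lemma bd_cone:
  assumes "finite \<Omega>" "p \<in> \<Omega>" "\<And>ys. bd \<Omega> F ys = 0"
  shows "bd \<Omega> (cone p F) ys = F ys"
proof -
  have "bd \<Omega> (cone p F) ys = F ys - cone p (bd \<Omega> F) ys"
    using assms(1,2) by (simp add: bd_def[abs_def] sum_subtractf cone_sum)
  also have "cone p (bd \<Omega> F) ys = 0" using assms(3) cone_zero cone_cong by metis
  finally show ?thesis by simp
qed

text \<open>The simplicial map induced by \<open>f\<close>; on alternating functions, lists on which \<open>f\<close> is not
  injective cancel in pairs.\<close>

definition push :: "'a set \<Rightarrow> ('a \<Rightarrow> 'a) \<Rightarrow> ('a list \<Rightarrow> int) \<Rightarrow> 'a list \<Rightarrow> int" where
  "push \<Omega> f F ys = (\<Sum>xs | set xs \<subseteq> \<Omega> \<and> map f xs = ys. F xs)"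

lemma finite_fiber: "finite \<Omega> \<Longrightarrow> finite {xs. set xs \<subseteq> \<Omega> \<and> map f xs = ys}"
  by (rule finite_subset[OF _ finite_lists_length_eq[of \<Omega> "length ys"]]) auto

lemma push_add: "push \<Omega> f (\<lambda>xs. F xs + G xs) ys = push \<Omega> f F ys + push \<Omega> f G ys"
  by (simp add: push_def sum.distrib)

lemma push_support:
  assumes "push \<Omega> f F ys \<noteq> 0"
  shows "\<exists>xs. F xs \<noteq> 0 \<and> set xs \<subseteq> \<Omega> \<and> map f xs = ys"
  using assms unfolding push_def by (metis (mono_tags, lifting) mem_Collect_eq sum.neutral)

lemma alternating_push:
  assumes "alternating F"
  shows "alternating (push \<Omega> f F)"
  unfolding alternating_def
proof (intro allI)
  fix as x y bs
  define S where "S = (\<lambda>x y. {zs. set zs \<subseteq> \<Omega> \<and> map f zs = as @ x # y # bs})"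
  define n where "n = length as"
  \<comment> \<open>Swapping the entries at positions \<open>n\<close> and \<open>n + 1\<close> is
    an involution that matches the fibres over the two lists and negates \<open>F\<close>.\<close>
  define \<tau> where "\<tau> = (\<lambda>zs :: 'a list. take n zs @ zs ! Suc n # zs ! n # drop (Suc (Suc n)) zs)"
  have S: "\<tau> zs \<in> S y x" "\<tau> (\<tau> zs) = zs" "- F (\<tau> zs) = F zs" if zs: "zs \<in> S x y" for zs x y
  proof -
    from zs obtain as' x' y' bs' where eq: "zs = as' @ x' # y' # bs'" "map f as' = as" "f x' = x" "f y' = y" "map f bs' = bs"
      by (auto simp: S_def map_eq_append_conv map_eq_Cons_conv)
    have "length as' = n" using eq(2) by (auto simp: n_def)
    then have \<tau>: "\<tau> (as' @ u # w # bs') = as' @ w # u # bs'" for u w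
      by (simp add: \<tau>_def nth_append)
    show "\<tau> zs \<in> S y x" "\<tau> (\<tau> zs) = zs"
      using zs eq(2-) by (simp_all add: eq(1) \<tau> S_def)
    show "- F (\<tau> zs) = F zs"
      using alternatingD[OF assms, of as' x' y' bs'] by (simp add: eq(1) \<tau>)
  qed
  have "(\<Sum>zs\<in>S x y. F zs) = (\<Sum>zs\<in>S y x. - F zs)"
    by (rule sum.reindex_bij_witness[of _ \<tau> \<tau>]) (use S in simp_all)
  then show "push \<Omega> f F (as @ x # y # bs) = - push \<Omega> f F (as @ y # x # bs)"
    by (simp add: push_def S_def sum_negf)
qed

lemma push_Cons:
  assumes "finite \<Omega>"
  shows "push \<Omega> f F (v # ys) = (\<Sum>u | u \<in> \<Omega> \<and> f u = v. push \<Omega> f (\<lambda>zs. F (u # zs)) ys)"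
proof -
  let ?U = "{u. u \<in> \<Omega> \<and> f u = v}" and ?W = "{xs. set xs \<subseteq> \<Omega> \<and> map f xs = ys}"
  have eq: "{xs. set xs \<subseteq> \<Omega> \<and> map f xs = v # ys} = (\<lambda>(u, zs). u # zs) ` (?U \<times> ?W)"
    by (auto simp: map_eq_Cons_conv image_iff)
  have "(\<Sum>xs\<in>(\<lambda>(u, zs). u # zs) ` (?U \<times> ?W). F xs) = (\<Sum>(u, zs)\<in>?U \<times> ?W. F (u # zs))"
    by (subst sum.reindex) (auto simp: inj_on_def intro: sum.cong)
  also have "\<dots> = (\<Sum>u\<in>?U. \<Sum>zs\<in>?W. F (u # zs))"
    by (rule sum.cartesian_product[symmetric])
  finally show ?thesis by (simp add: push_def eq)
qed

text \<open>Each added vertex \<open>v\<close> of the image is replaced by its preimages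
  \<open>u\<close>; summing over all \<open>v\<close> then runs through every
  \<open>u \<in> \<Omega>\<close> once.\<close>

lemma bd_push:
  assumes "finite \<Omega>" "f ` \<Omega> \<subseteq> \<Omega>"
  shows "bd \<Omega> (push \<Omega> f F) ys = push \<Omega> f (bd \<Omega> F) ys"
proof -
  have "bd \<Omega> (push \<Omega> f F) ys = (\<Sum>v\<in>\<Omega>. \<Sum>u | u \<in> \<Omega> \<and> f u = v. push \<Omega> f (\<lambda>zs. F (u # zs)) ys)"
    by (simp add: bd_def push_Cons[OF assms(1)])
  also have "\<dots> = (\<Sum>u\<in>\<Omega>. push \<Omega> f (\<lambda>zs. F (u # zs)) ys)"
    by (rule sum.group) (use assms in auto)
  also have "\<dots> = push \<Omega> f (bd \<Omega> F) ys"
    unfolding push_def bd_def by (rule sum.swap)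
  finally show ?thesis .
qed

lemma push_id_on:
  assumes "finite \<Omega>" "A \<subseteq> \<Omega>" "\<And>v. v \<in> A \<Longrightarrow> f v = v" "\<And>xs. F xs \<noteq> 0 \<Longrightarrow> set xs \<subseteq> A"
  shows "push \<Omega> f F ys = F ys"
proof -
  have id: "map f xs = xs" if "F xs \<noteq> 0" for xs
    using assms(3) assms(4)[OF that] by (auto intro: map_idI)
  have "push \<Omega> f F ys = (\<Sum>xs | set xs \<subseteq> \<Omega> \<and> map f xs = ys. if xs = ys then F ys else 0)"
    unfolding push_def by (intro sum.cong) (use id in \<open>auto, metis+\<close>)
  also have "\<dots> = F ys"
    unfolding sum.delta[OF finite_fiber[OF assms(1)]] using id[of ys] assms(2) assms(4)[of ys] by auto
  finally show ?thesis .
qed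

text \<open>The triangle inequality on each fibre over a distinct list; over the other lists the
  image vanishes. Only words that survive \<open>f\<close> without collision count on the right,
  which is what lets two collapses share the norm of one filling.\<close>

lemma norm_push:
  assumes "finite \<Omega>" "f ` \<Omega> \<subseteq> \<Omega>" and F: "alternating F"
  shows "(\<Sum>ys\<in>words k \<Omega>. \<bar>push \<Omega> f F ys\<bar>) \<le> (\<Sum>xs\<in>words k \<Omega>. if distinct (map f xs) then \<bar>F xs\<bar> else 0)"
proof -
  have "\<bar>push \<Omega> f F ys\<bar> \<le> (\<Sum>xs | xs \<in> words k \<Omega> \<and> map f xs = ys. if distinct (map f xs) then \<bar>F xs\<bar> else 0)"
    if "ys \<in> words k \<Omega>" for ys
  proof (cases "distinct ys")
    case True
    have "\<bar>push \<Omega> f F ys\<bar> \<le> (\<Sum>xs | set xs \<subseteq> \<Omega> \<and> map f xs = ys. \<bar>F xs\<bar>)"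
      unfolding push_def by (rule sum_abs)
    also have "\<dots> = (\<Sum>xs | xs \<in> words k \<Omega> \<and> map f xs = ys. if distinct (map f xs) then \<bar>F xs\<bar> else 0)"
      using True that by (intro sum.cong) auto
    finally show ?thesis .
  next
    case False
    then show ?thesis
      using alternating_not_distinct[OF alternating_push[OF F]] by (auto intro!: sum_nonneg)
  qed
  then have "(\<Sum>ys\<in>words k \<Omega>. \<bar>push \<Omega> f F ys\<bar>) \<le>
      (\<Sum>ys\<in>words k \<Omega>. \<Sum>xs | xs \<in> words k \<Omega> \<and> map f xs = ys. if distinct (map f xs) then \<bar>F xs\<bar> else 0)"
    by (rule sum_mono)
  also have "\<dots> = (\<Sum>xs\<in>words k \<Omega>. if distinct (map f xs) then \<bar>F xs\<bar> else 0)"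
  proof (rule sum.group)
    have "map f xs \<in> words k \<Omega>" if "xs \<in> words k \<Omega>" for xs
      using that assms(2) by fastforce
    then show "map f ` words k \<Omega> \<subseteq> words k \<Omega>" by (rule image_subsetI)
  qed (rule finite_lists_length_eq[OF assms(1)])+
  finally show ?thesis .
qed

section \<open>Fillings\<close>

text \<open>Passing to coefficient functions replaces \<open>boundary\<close>, with its chosen
  orientations, by \<open>bd\<close>.\<close>

lemma filling_iff:
  assumes "finite \<Omega>"
  shows "filling \<Omega> n X M \<longleftrightarrow> M \<in> chains (n + 1) \<Omega> \<and> bd \<Omega> (coeff M) = coeff X"
  unfolding filling_def using lookup_boundary[OF assms] by (metis lookup_inject)

lemma cycles_bd:
  assumes "finite \<Omega>" "A \<subseteq> \<Omega>" "X \<in> cycles n A"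
  shows "X \<in> chains n \<Omega>" "bd \<Omega> (coeff X) ys = 0"
proof -
  show "X \<in> chains n \<Omega>" using assms chains_mono by (auto simp: cycles_def)
  from lookup_boundary[OF assms(1) this] show "bd \<Omega> (coeff X) ys = 0"
    using assms(3) by (metis (mono_tags, lifting) cycles_def lookup_zero mem_Collect_eq)
qed

text \<open>A cone over \<open>X\<close> from any vertex is a filling. Without vertices there is no
  apex, but then \<open>X\<close> is 0 because its simplices would be nonempty lists.\<close>

lemma ex_filling:
  assumes "finite \<Omega>" "A \<subseteq> \<Omega>" "X \<in> cycles n A"
  shows "\<exists>M. filling \<Omega> n X M"
proof (cases "\<Omega> = {}")
  case True
  have "coeff X xs = 0" for xs
    using chains_set[OF cycles_bd(1)[OF assms], of xs] chains_length[OF cycles_bd(1)[OF assms], of xs] True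
    by (cases xs) auto
  then show ?thesis
    using assms(1) by (intro exI[of _ 0]) (auto simp: filling_iff chains_altdef bd_def alternating_def)
next
  case False
  then obtain p where p: "p \<in> \<Omega>" by blast
  have "alternating (cone p (coeff X))"
    using chains_alternating[OF cycles_bd(1)[OF assms]] by (rule alternating_cone)
  moreover have "length xs = n + 1 + 1 \<and> set xs \<subseteq> \<Omega>" if "cone p (coeff X) xs \<noteq> 0" for xs
    using cone_support[OF that] chains_length[OF cycles_bd(1)[OF assms]] chains_set[OF cycles_bd(1)[OF assms]] p
    by fastforce
  ultimately obtain M where "M \<in> chains (n + 1) \<Omega>" "coeff M = cone p (coeff X)"
    using ex_chain[OF assms(1)] by blast
  moreover have "bd \<Omega> (cone p (coeff X)) = coeff X"
    by (rule ext) (rule bd_cone[OF assms(1) p cycles_bd(2)[OF assms]])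
  ultimately have "filling \<Omega> n X M" by (simp add: filling_iff[OF assms(1)])
  then show ?thesis by blast
qed

lemma Zvol_le: "filling \<Omega> n X M \<Longrightarrow> Zvol \<Omega> n X \<le> l1_norm M"
  unfolding Zvol_def by (rule Least_le) blast

lemma ex_taut_filling:
  assumes "filling \<Omega> n X M"
  shows "\<exists>M. taut_filling \<Omega> n X M"
proof -
  have "\<exists>M. filling \<Omega> n X M \<and> l1_norm M = Zvol \<Omega> n X"
    unfolding Zvol_def by (rule LeastI) (use assms in blast)
  then show ?thesis by (simp add: taut_filling_def)
qed

lemma filling_add:
  assumes "finite \<Omega>" "filling \<Omega> n X M" "filling \<Omega> n Y N"
  shows "filling \<Omega> n (X + Y) (M + N)"
proof -
  have "bd \<Omega> (coeff (M + N)) ys = bd \<Omega> (coeff M) ys + bd \<Omega> (coeff N) ys" for ys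
    by (simp add: bd_def lookup_add sum.distrib)
  then show ?thesis
    using assms(2,3) chains_add by (auto simp: filling_iff[OF assms(1)] lookup_add fun_eq_iff)
qed

lemma l1_norm_leI:
  assumes "finite \<Omega>" "M \<in> chains k \<Omega>" "N \<in> chains k \<Omega>" "K \<in> chains k \<Omega>"
    and "(\<Sum>xs\<in>words (k + 1) \<Omega>. \<bar>coeff M xs\<bar>) \<le>
      (\<Sum>xs\<in>words (k + 1) \<Omega>. \<bar>coeff N xs\<bar>) + (\<Sum>xs\<in>words (k + 1) \<Omega>. \<bar>coeff K xs\<bar>)"
  shows "l1_norm M \<le> l1_norm N + l1_norm K"
proof -
  have "fact (k + 1) * int (l1_norm M) \<le> fact (k + 1) * (int (l1_norm N) + int (l1_norm K))"
    unfolding distrib_left using assms by (simp only: l1_norm_words)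
  then have "int (l1_norm M) \<le> int (l1_norm N) + int (l1_norm K)"
    by (subst (asm) mult_le_cancel_left_pos) (simp_all only: fact_gt_zero)
  then show ?thesis by simp
qed

lemma l1_norm_triangle:
  assumes "finite \<Omega>" "M \<in> chains k \<Omega>" "N \<in> chains k \<Omega>"
  shows "l1_norm (M + N) \<le> l1_norm M + l1_norm N"
  by (rule l1_norm_leI[OF assms(1) chains_add])
     (use assms in \<open>auto simp: lookup_add sum.distrib[symmetric] intro!: sum_mono\<close>)

text \<open>A condition on vertex sets is blind to orientation, so both restrictions are again
  chains; their supports are disjoint, so the norms add up exactly.\<close>

lemma split_chain:
  fixes M :: "'a list \<Rightarrow>\<^sub>0 int"
  assumes "finite \<Omega>" "M \<in> chains k \<Omega>"
  obtains M1 M2 where "M1 \<in> chains k \<Omega>" "M2 \<in> chains k \<Omega>" "M = M1 + M2"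
    "l1_norm M1 + l1_norm M2 = l1_norm M"
    "\<And>xs. coeff M1 xs = (if P (set xs) then coeff M xs else 0)"
    "\<And>xs. coeff M2 xs = (if P (set xs) then 0 else coeff M xs)"
proof -
  have part: "\<exists>N. N \<in> chains k \<Omega> \<and> coeff N = (\<lambda>xs. if Q (set xs) then coeff M xs else 0)" for Q
  proof -
    have "alternating (\<lambda>xs. if Q (set xs) then coeff M xs else 0)"
    proof (rule alternatingI)
      fix as bs :: "'a list" and x y
      have "set (as @ x # y # bs) = set (as @ y # x # bs)" by auto
      then show "(if Q (set (as @ x # y # bs)) then coeff M (as @ x # y # bs) else 0) =
          - (if Q (set (as @ y # x # bs)) then coeff M (as @ y # x # bs) else 0)"
        using alternatingD[OF chains_alternating[OF assms(2)], of as x y bs] by simp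
    qed
    then show ?thesis
    proof (rule ex_chain[OF assms(1), of _ k])
      show "length xs = k + 1 \<and> set xs \<subseteq> \<Omega>" if "(if Q (set xs) then coeff M xs else 0) \<noteq> 0" for xs
        using that chains_length[OF assms(2), of xs] chains_set[OF assms(2), of xs] by (simp split: if_splits)
    qed blast
  qed
  obtain M1 where M1: "M1 \<in> chains k \<Omega>" "coeff M1 = (\<lambda>xs. if P (set xs) then coeff M xs else 0)"
    using part[of P] by blast
  obtain M2 where M2: "M2 \<in> chains k \<Omega>" "coeff M2 = (\<lambda>xs. if \<not> P (set xs) then coeff M xs else 0)"
    using part[of "\<lambda>s. \<not> P s"] by blast
  have sum: "M = M1 + M2"
    by (rule poly_mapping_eqI) (simp add: lookup_add M1(2) M2(2))
  have "fact (k + 1) * int (l1_norm M1 + l1_norm M2) = fact (k + 1) * int (l1_norm M1) + fact (k + 1) * int (l1_norm M2)"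
    by (simp only: of_nat_add distrib_left)
  also have "\<dots> = fact (k + 1) * int (l1_norm M)"
    unfolding l1_norm_words[OF assms(1) M1(1)] l1_norm_words[OF assms(1) M2(1)] l1_norm_words[OF assms]
      sum.distrib[symmetric] M1(2) M2(2)
    by (intro sum.cong) auto
  finally have "l1_norm M1 + l1_norm M2 = l1_norm M" by (simp only: mult_cancel_left fact_nonzero of_nat_eq_iff) simp
  then show thesis using that[OF M1(1) M2(1) sum] M1(2) M2(2) by simp
qed

text \<open>Stated for a general vertex map so that it serves both collapses, the second time with
  the roles of \<open>A\<close> and \<open>B\<close> exchanged.\<close>

lemma push_filling:
  assumes "finite \<Omega>" "A \<subseteq> \<Omega>" "B \<subseteq> \<Omega>" "X \<in> chains n A" "Y \<in> cycles n B"
    and M: "filling \<Omega> n (X + Y) M"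
    and f: "f ` \<Omega> \<subseteq> \<Omega>" "\<And>v. v \<in> A \<Longrightarrow> f v = v" "card (f ` B) \<le> n + 1"
  shows "\<exists>MX. filling \<Omega> n X MX \<and> coeff MX = push \<Omega> f (coeff M)"
proof -
  have Mc: "M \<in> chains (n + 1) \<Omega>" and Mb: "bd \<Omega> (coeff M) = coeff (X + Y)"
    using M by (auto simp: filling_iff[OF assms(1)])
  note Y = cycles_bd[OF assms(1,3,5)]
  have YB: "Y \<in> chains n B" using assms(5) by (simp add: cycles_def)
  have "push \<Omega> f (coeff Y) ys = 0" for ys
  proof (rule cycle_few_vertices[OF assms(1) _ f(3)])
    show "f ` B \<subseteq> \<Omega>" using f(1) assms(3) by blast
    show "alternating (push \<Omega> f (coeff Y))" using chains_alternating[OF Y(1)] by (rule alternating_push)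
    show "length xs = n + 1 \<and> set xs \<subseteq> f ` B" if "push \<Omega> f (coeff Y) xs \<noteq> 0" for xs
      using push_support[OF that] chains_length[OF YB] chains_set[OF YB] by fastforce
    have "bd \<Omega> (coeff Y) = (\<lambda>_. 0)" using Y(2) by auto
    then show "bd \<Omega> (push \<Omega> f (coeff Y)) ys = 0" for ys
      by (simp add: bd_push[OF assms(1) f(1)] push_def)
  qed
  moreover have "push \<Omega> f (coeff X) ys = coeff X ys" for ys
    using chains_set[OF assms(4)] f(2) by (intro push_id_on[OF assms(1,2)]) auto
  ultimately have bd: "bd \<Omega> (push \<Omega> f (coeff M)) = coeff X"
    by (simp add: fun_eq_iff bd_push[OF assms(1) f(1)] Mb lookup_add[abs_def] push_add)
  have "alternating (push \<Omega> f (coeff M))" using chains_alternating[OF Mc] by (rule alternating_push)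
  moreover have "length xs = n + 1 + 1 \<and> set xs \<subseteq> \<Omega>" if "push \<Omega> f (coeff M) xs \<noteq> 0" for xs
    using push_support[OF that] chains_length[OF Mc] f(1) by fastforce
  ultimately obtain MX where "MX \<in> chains (n + 1) \<Omega>" "coeff MX = push \<Omega> f (coeff M)"
    using ex_chain[OF assms(1)] by blast
  then show ?thesis using bd by (auto simp: filling_iff[OF assms(1)])
qed

section \<open>Collapsing onto \<open>A\<close> and onto \<open>B\<close>\<close>

definition collapse :: "'a set \<Rightarrow> 'a \<Rightarrow> 'a \<Rightarrow> 'a" where
  "collapse A c v = (if v \<in> A then v else c)"

text \<open>All vertices outside \<open>A\<close> land on \<open>c\<close>, so at most one of them
  can be present, and none if \<open>c\<close> is itself a vertex of the simplex lying in
  \<open>A\<close>.\<close>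

lemma distinct_collapseD:
  assumes "distinct (map (collapse A c) xs)"
  shows "card (set xs - A) \<le> 1" "c \<in> set xs \<Longrightarrow> c \<in> A \<Longrightarrow> set xs \<subseteq> A"
proof -
  have inj: "u = v" if "u \<in> set xs" "v \<in> set xs" "collapse A c u = collapse A c v" for u v
    using assms that by (auto simp: distinct_map inj_on_def)
  show "card (set xs - A) \<le> 1"
    using inj by (auto simp: card_le_Suc0_iff_eq collapse_def)
  show "c \<in> set xs \<Longrightarrow> c \<in> A \<Longrightarrow> set xs \<subseteq> A"
    using inj[of _ c] unfolding collapse_def by (intro subsetI) metis
qed

lemma card_le_three_parts:
  assumes "finite s"
  shows "card s \<le> card (s - A) + card (s - B) + card (s \<inter> (A \<inter> B))"
proof -
  have "card s \<le> card ((s - A) \<union> (s - B) \<union> (s \<inter> (A \<inter> B)))"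
    using assms by (intro card_mono) auto
  also have "\<dots> \<le> card (s - A) + card (s - B) + card (s \<inter> (A \<inter> B))"
    by (meson add_right_mono card_Un_le order_trans)
  finally show ?thesis .
qed

text \<open>The pairs of vertices to which the complements of \<open>A\<close> and of \<open>B\<close> may be collapsed.\<close>

definition apexes :: "nat \<Rightarrow> 'a set \<Rightarrow> 'a set \<Rightarrow> 'a set \<Rightarrow> 'a \<Rightarrow> 'a \<Rightarrow> bool" where
  "apexes n A B \<Omega> a b \<longleftrightarrow>
     (if A \<inter> B = {} then \<Omega> \<noteq> {} \<longrightarrow> a \<in> \<Omega> \<and> b \<in> \<Omega>
      else a \<in> A \<inter> B \<and> b \<in> A \<inter> B \<and> (card (A \<inter> B) \<le> n \<or> a \<noteq> b))"

lemma apexesI: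
  assumes "a \<in> A \<inter> B" "b \<in> A \<inter> B" "card (A \<inter> B) \<le> n \<or> a \<noteq> b"
  shows "apexes n A B \<Omega> a b"
proof -
  have "A \<inter> B \<noteq> {}" using assms(1) by blast
  then show ?thesis unfolding apexes_def using assms by (simp only: if_False simp_thms)
qed

text \<open>Distinct apexes are required only when \<open>A \<inter> B\<close> has more than
  \<open>n\<close> vertices; \<open>n \<ge> 1\<close> then guarantees two.\<close>

lemma ex_apexes:
  assumes "n \<ge> 1"
  shows "\<exists>a b. apexes n A B \<Omega> a b"
proof (cases "A \<inter> B = {}")
  case True
  show ?thesis
  proof (cases "\<Omega> = {}")
    case False
    then obtain p where "p \<in> \<Omega>" by blast
    then show ?thesis using True by (intro exI[of _ p]) (simp add: apexes_def)
  qed (simp add: apexes_def True)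
next
  case False
  show ?thesis
  proof (cases "card (A \<inter> B) \<le> n")
    case True
    obtain p where "p \<in> A \<inter> B" using False by blast
    then show ?thesis using True by (intro exI[of _ p] apexesI disjI1)
  next
    case large: False
    then have "\<not> card (A \<inter> B) \<le> Suc 0" using assms by linarith
    moreover have fin: "finite (A \<inter> B)" using large card.infinite[of "A \<inter> B"] by linarith
    ultimately obtain a b where "a \<in> A \<inter> B" "b \<in> A \<inter> B" "a \<noteq> b"
      unfolding card_le_Suc0_iff_eq[OF fin] by blast
    then show ?thesis by (intro exI[of _ a] exI[of _ b] apexesI disjI2)
  qed
qed

text \<open>A doubly surviving simplex has at most one vertex outside each of \<open>A\<close> and
  \<open>B\<close>, hence at least \<open>n\<close> in \<open>A \<inter> B\<close>. The choice of
  apexes excludes the few configurations left.\<close>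

lemma not_distinct_both_collapses:
  assumes "n \<ge> 1" and fin: "finite (A \<inter> B)" and C: "card (A \<inter> B) \<le> n + 1"
    and ab: "apexes n A B \<Omega> a b"
    and xs: "distinct xs" "length xs = n + 2"
    and f: "distinct (map (collapse A a) xs)" and g: "distinct (map (collapse B b) xs)"
  shows False
proof -
  let ?s = "set xs" and ?C = "A \<inter> B"
  have card: "card ?s = n + 2" using xs by (simp add: distinct_card)
  have parts: "n + 2 \<le> card (?s - A) + card (?s - B) + card (?s \<inter> ?C)"
    using card_le_three_parts[of ?s A B] card by simp
  then have n: "n \<le> card (?s \<inter> ?C)"
    using distinct_collapseD(1)[OF f] distinct_collapseD(1)[OF g] by simp
  then have ne: "?C \<noteq> {}" using assms(1) by auto
  then have ab': "a \<in> ?C" "b \<in> ?C" "card ?C \<le> n \<or> a \<noteq> b" using ab unfolding apexes_def by metis+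
  \<comment> \<open>With both apexes among its vertices, the simplex would lie in \<open>A\<close>
    and in \<open>B\<close>, but \<open>n + 2\<close> vertices do not fit into
    \<open>A \<inter> B\<close>.\<close>
  have "\<not> ?s \<subseteq> ?C" using card_mono[OF fin, of ?s] card C by linarith
  then have not_both: "\<not> (a \<in> ?s \<and> b \<in> ?s)"
    using distinct_collapseD(2)[OF f] distinct_collapseD(2)[OF g] ab' by blast
  have lt: "card (?s \<inter> ?C) < card ?C"
  proof (rule ccontr)
    assume "\<not> ?thesis"
    then have "?s \<inter> ?C = ?C" using fin by (intro card_seteq) auto
    then show False using not_both ab' by blast
  qed
  then have "card ?C = n + 1" using n C by linarith
  moreover from this have "a \<noteq> b" using ab'(3) by linarith
  ultimately have big: "card ?C = n + 1" "a \<noteq> b" .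
  \<comment> \<open>At most one vertex of \<open>A \<inter> B\<close> is missing, so one of the two
    distinct apexes is present and puts the simplex inside \<open>A\<close> or inside
    \<open>B\<close>. One summand of \<open>parts\<close> then drops out, which forces all
    \<open>n + 1\<close> vertices of \<open>A \<inter> B\<close> to be present.\<close>
  have "card (?C - ?s) \<le> 1"
    using n big(1) card_Diff_subset_Int[of ?C ?s] fin by (simp add: Int_commute)
  then have "\<not> (a \<notin> ?s \<and> b \<notin> ?s)"
    using big(2) ab'(1,2) card_le_Suc0_iff_eq[of "?C - ?s"] fin by auto
  then have "?s - A = {} \<or> ?s - B = {}"
    using distinct_collapseD(2)[OF f] distinct_collapseD(2)[OF g] ab' by blast
  then have "n + 1 \<le> card (?s \<inter> ?C)"
    using parts distinct_collapseD(1)[OF f] distinct_collapseD(1)[OF g] by (elim disjE) simp_all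
  then show False using lt big(1) by linarith
qed

text \<open>The final implication records the case of equality: if no norm is lost, every simplex of
  \<open>M\<close> survives a collapse.\<close>

lemma collapse_fillings:
  assumes "n \<ge> 1" "finite \<Omega>" "A \<subseteq> \<Omega>" "B \<subseteq> \<Omega>" and C: "card (A \<inter> B) \<le> n + 1"
    and X: "X \<in> cycles n A" and Y: "Y \<in> cycles n B"
    and ab: "apexes n A B \<Omega> a b"
    and M: "filling \<Omega> n (X + Y) M"
  shows "\<exists>MX MY. filling \<Omega> n X MX \<and> filling \<Omega> n Y MY \<and> l1_norm MX + l1_norm MY \<le> l1_norm M \<and>
    (l1_norm M \<le> l1_norm MX + l1_norm MY \<longrightarrow>
      (\<forall>xs. coeff M xs \<noteq> 0 \<longrightarrow> distinct (map (collapse A a) xs) \<or> distinct (map (collapse B b) xs)))"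
proof -
  let ?f = "collapse A a" and ?g = "collapse B b" and ?W = "words (n + 1 + 1) \<Omega>"
  let ?F = "\<lambda>xs. if distinct (map ?f xs) then \<bar>coeff M xs\<bar> else 0"
  let ?G = "\<lambda>xs. if distinct (map ?g xs) then \<bar>coeff M xs\<bar> else 0"
  have fin: "finite A" "finite B" "finite ?W"
    using finite_subset[OF assms(3,2)] finite_subset[OF assms(4,2)] finite_lists_length_eq[OF assms(2)] by simp_all
  have Mc: "M \<in> chains (n + 1) \<Omega>" using M by (simp add: filling_def)
  note alt = chains_alternating[OF Mc]
  have f: "?f ` \<Omega> \<subseteq> \<Omega>" and g: "?g ` \<Omega> \<subseteq> \<Omega>"
    using ab assms(3,4) by (auto simp: apexes_def collapse_def split: if_splits)
  \<comment> \<open>The image of \<open>B\<close> adds at most the apex to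
    \<open>A \<inter> B\<close>: either the apex is already there, or the image is at most one
    point.\<close>
  have "card (insert c (A \<inter> B)) \<le> n + 1" if "A \<inter> B = {} \<or> c \<in> A \<inter> B" for c
    using that C by (auto simp: insert_absorb)
  moreover have "?f ` B \<subseteq> insert a (A \<inter> B)" "?g ` A \<subseteq> insert b (A \<inter> B)"
    by (auto simp: collapse_def)
  moreover have "A \<inter> B = {} \<or> a \<in> A \<inter> B" "A \<inter> B = {} \<or> b \<in> A \<inter> B"
    using ab unfolding apexes_def by metis+
  ultimately have "card (?f ` B) \<le> n + 1" "card (?g ` A) \<le> n + 1"
    using fin by (meson card_mono finite_Int finite_insert order_trans)+
  then obtain MX MY where MX: "filling \<Omega> n X MX" "coeff MX = push \<Omega> ?f (coeff M)"
    and MY: "filling \<Omega> n Y MY" "coeff MY = push \<Omega> ?g (coeff M)"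
    using push_filling[OF assms(2,3,4) _ Y M f] push_filling[OF assms(2,4,3) _ X _ g, of Y M] X Y M
    by (auto simp: cycles_def collapse_def add.commute)
  have XYc: "MX \<in> chains (n + 1) \<Omega>" "MY \<in> chains (n + 1) \<Omega>"
    using MX(1) MY(1) by (auto simp: filling_def)
  have le: "?F xs + ?G xs \<le> \<bar>coeff M xs\<bar>" for xs
  proof (cases "coeff M xs = 0")
    case False
    then have "\<not> (distinct (map ?f xs) \<and> distinct (map ?g xs))"
      using not_distinct_both_collapses[OF assms(1) _ C ab] chains_distinct[OF Mc] chains_length[OF Mc] fin
      by fastforce
    then show ?thesis by auto
  qed simp
  have norm: "fact (n + 1 + 1) * int (l1_norm MX + l1_norm MY) \<le> (\<Sum>xs\<in>?W. ?F xs + ?G xs)"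
    unfolding of_nat_add distrib_left sum.distrib l1_norm_words[OF assms(2) XYc(1)] l1_norm_words[OF assms(2) XYc(2)]
      MX(2) MY(2)
    by (intro add_mono norm_push assms f g alt)
  also have "\<dots> \<le> (\<Sum>xs\<in>?W. \<bar>coeff M xs\<bar>)" by (intro sum_mono le)
  also have "\<dots> = fact (n + 1 + 1) * int (l1_norm M)" by (rule l1_norm_words[OF assms(2) Mc, symmetric])
  finally have 1: "l1_norm MX + l1_norm MY \<le> l1_norm M"
    by (subst (asm) mult_le_cancel_left_pos) (simp_all only: fact_gt_zero of_nat_le_iff)
  have 2: "distinct (map ?f xs) \<or> distinct (map ?g xs)"
    if tight: "l1_norm M \<le> l1_norm MX + l1_norm MY" and xs: "coeff M xs \<noteq> 0" for xs
  proof (rule ccontr)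
    assume neg: "\<not> (distinct (map ?f xs) \<or> distinct (map ?g xs))"
    have "xs \<in> ?W" using chains_length[OF Mc xs] chains_set[OF Mc xs] by simp
    \<comment> \<open>A word killed by both collapses makes the wordwise estimate strict there,
      hence strict in the sum.\<close>
    then have "(\<Sum>xs\<in>?W. ?F xs + ?G xs) < (\<Sum>xs\<in>?W. \<bar>coeff M xs\<bar>)"
      using le neg xs by (intro sum_strict_mono_ex1[OF fin(3)]) auto
    also have "\<dots> = fact (n + 1 + 1) * int (l1_norm M)" by (rule l1_norm_words[OF assms(2) Mc, symmetric])
    also have "\<dots> \<le> fact (n + 1 + 1) * int (l1_norm MX + l1_norm MY)"
      using tight by (intro mult_left_mono) (simp_all only: of_nat_le_iff fact_ge_zero)
    finally show False using norm by simp
  qed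
  show ?thesis using MX(1) MY(1) 1 2 by blast
qed

section \<open>Additivity of the filling volume\<close>

lemma Zvol_add:
  assumes "n \<ge> 1" "finite \<Omega>" "A \<subseteq> \<Omega>" "B \<subseteq> \<Omega>" "card (A \<inter> B) \<le> n + 1"
    and "X \<in> cycles n A" "Y \<in> cycles n B"
  shows "Zvol \<Omega> n (X + Y) = Zvol \<Omega> n X + Zvol \<Omega> n Y"
proof (rule antisym)
  obtain MX MY where MX: "taut_filling \<Omega> n X MX" and MY: "taut_filling \<Omega> n Y MY"
    using ex_filling ex_taut_filling assms by meson
  then have fill: "filling \<Omega> n (X + Y) (MX + MY)"
    using filling_add[OF assms(2)] by (auto simp: taut_filling_def)
  have "Zvol \<Omega> n (X + Y) \<le> l1_norm (MX + MY)" by (rule Zvol_le[OF fill])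
  also have "\<dots> \<le> l1_norm MX + l1_norm MY"
    using MX MY by (intro l1_norm_triangle[OF assms(2)]) (auto simp: taut_filling_def filling_def)
  finally show "Zvol \<Omega> n (X + Y) \<le> Zvol \<Omega> n X + Zvol \<Omega> n Y"
    using MX MY by (simp add: taut_filling_def)
  obtain M where M: "taut_filling \<Omega> n (X + Y) M" using fill ex_taut_filling by blast
  obtain a b where "apexes n A B \<Omega> a b" using ex_apexes[of n A B \<Omega>, OF assms(1)] by blast
  then obtain NX NY where "filling \<Omega> n X NX" "filling \<Omega> n Y NY" "l1_norm NX + l1_norm NY \<le> l1_norm M"
    using collapse_fillings[OF assms] M unfolding taut_filling_def by blast
  then show "Zvol \<Omega> n X + Zvol \<Omega> n Y \<le> Zvol \<Omega> n (X + Y)"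
    using Zvol_le[of \<Omega> n X NX] Zvol_le[of \<Omega> n Y NY] M by (simp add: taut_filling_def)
qed

section \<open>The shape and decomposition of taut fillings\<close>

text \<open>Equality in the collapse estimate holds for every admissible pair of apexes, so the pair
  may be adapted to the simplex under study.\<close>

lemma taut_filling_simplex:
  assumes n: "n \<ge> 2" and "finite \<Omega>" "A \<subseteq> \<Omega>" "B \<subseteq> \<Omega>" and C: "card (A \<inter> B) \<le> n + 1"
    and "X \<in> cycles n A" "Y \<in> cycles n B"
    and M: "taut_filling \<Omega> n (X + Y) M" and xs: "coeff M xs \<noteq> 0"
  shows "set xs \<subseteq> A \<or> set xs \<subseteq> B \<or>
    (set xs \<inter> (A \<inter> B) = {} \<and> (card (set xs - A) \<le> 1 \<or> card (set xs - B) \<le> 1))"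
proof -
  have n1: "n \<ge> 1" using n by simp
  have Mc: "M \<in> chains (n + 1) \<Omega>" using M by (simp add: taut_filling_def filling_def)
  have fin: "finite (A \<inter> B)" using assms(2,3) finite_subset by blast
  have one: "distinct (map (collapse A a) xs) \<or> distinct (map (collapse B b) xs)"
    if ab: "apexes n A B \<Omega> a b" for a b
  proof -
    obtain MX MY where "filling \<Omega> n X MX" "filling \<Omega> n Y MY" and
      tight: "l1_norm M \<le> l1_norm MX + l1_norm MY \<longrightarrow>
        (\<forall>xs. coeff M xs \<noteq> 0 \<longrightarrow> distinct (map (collapse A a) xs) \<or> distinct (map (collapse B b) xs))"
      using collapse_fillings[OF n1 assms(2-7) ab] M unfolding taut_filling_def by blast
    \<comment> \<open>Each image has norm at least the volume of the cycle it fills, and by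
      additivity these volumes sum to the norm of \<open>M\<close>.\<close>
    then have "l1_norm M \<le> l1_norm MX + l1_norm MY"
      using Zvol_le[of \<Omega> n X MX] Zvol_le[of \<Omega> n Y MY] Zvol_add[OF n1 assms(2-7)] M
      by (simp add: taut_filling_def)
    then show ?thesis using tight xs by blast
  qed
  show ?thesis
  proof (cases "set xs \<inter> (A \<inter> B) = {}")
    case True
    obtain a b where "apexes n A B \<Omega> a b" using ex_apexes[of n A B \<Omega>, OF n1] by blast
    from one[OF this] show ?thesis using True distinct_collapseD(1) by metis
  next
    case False
    then obtain x where x: "x \<in> set xs" "x \<in> A" "x \<in> B" by blast
    show ?thesis
    proof (rule ccontr)
      assume neg: "\<not> ?thesis"
      have f: "\<not> distinct (map (collapse A c) xs)" if "c \<in> set xs" "c \<in> A" for c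
        using distinct_collapseD(2) that neg by metis
      have g: "\<not> distinct (map (collapse B c) xs)" if "c \<in> set xs" "c \<in> B" for c
        using distinct_collapseD(2) that neg by metis
      \<comment> \<open>Apexes taken from the simplex itself would kill it under both collapses,
        since it lies neither in \<open>A\<close> nor in \<open>B\<close>.\<close>
      have no: "\<not> apexes n A B \<Omega> a b" if "a \<in> set xs \<inter> (A \<inter> B)" "b \<in> set xs \<inter> (A \<inter> B)" for a b
        using one f g that by blast
      have apex: "apexes n A B \<Omega> a b" if "a \<in> A \<inter> B" "b \<in> A \<inter> B" "a \<noteq> b" for a b
        using that by (intro apexesI disjI2)
      have "\<not> card (A \<inter> B) \<le> n"
        using no[of x x] x apexesI[of x A B x n \<Omega>] by blast
      then have "\<not> card (A \<inter> B) \<le> Suc 0" using n by simp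
      then obtain y where y: "y \<in> A \<inter> B" "y \<noteq> x"
        unfolding card_le_Suc0_iff_eq[OF fin] by blast
      \<comment> \<open>With apex \<open>x\<close> on the \<open>A\<close> side the first collapse
        fails, so the second one must succeed; exchanging the apexes gives the other bound.\<close>
      have "card (set xs - B) \<le> 1"
        using one[OF apex[of x y]] f[of x] x y by (intro distinct_collapseD(1)[of B y]) blast
      moreover have "card (set xs - A) \<le> 1"
        using one[OF apex[of y x]] g[of x] x y by (intro distinct_collapseD(1)[of A y]) blast
      moreover have "card (set xs) = n + 2"
        using chains_distinct[OF Mc xs] chains_length[OF Mc xs] by (simp add: distinct_card)
      \<comment> \<open>At least \<open>n\<close> vertices lie in \<open>A \<inter> B\<close>, and
        \<open>n \<ge> 2\<close> supplies two distinct ones: an admissible pair inside the simplex,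
        contrary to \<open>no\<close>.\<close>
      ultimately have "\<not> card (set xs \<inter> (A \<inter> B)) \<le> Suc 0"
        using card_le_three_parts[of "set xs" A B] n by simp
      then obtain u w where "u \<in> set xs \<inter> (A \<inter> B)" "w \<in> set xs \<inter> (A \<inter> B)" "u \<noteq> w"
        by (subst (asm) card_le_Suc0_iff_eq) auto
      then show False using no[of u w] apex[of u w] by blast
    qed
  qed
qed

lemma taut_filling_decompose:
  assumes n: "n \<ge> 2" and "finite \<Omega>" "A \<subseteq> \<Omega>" "B \<subseteq> \<Omega>" and C: "card (A \<inter> B) \<le> n + 1"
    and X: "X \<in> cycles n A" and Y: "Y \<in> cycles n B"
    and M: "taut_filling \<Omega> n (X + Y) M"
  shows "\<exists>MX MY. taut_filling \<Omega> n X MX \<and> taut_filling \<Omega> n Y MY \<and> M = MX + MY"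
proof -
  let ?far = "\<lambda>S s. s \<subseteq> S \<or> s \<inter> (A \<inter> B) = {} \<and> card (s - S) \<le> 1"
  have Mc: "M \<in> chains (n + 1) \<Omega>" and Mb: "bd \<Omega> (coeff M) = coeff (X + Y)"
    using M by (simp_all add: taut_filling_def filling_iff[OF assms(2)])
  obtain M1 M2 where M12: "M1 \<in> chains (n + 1) \<Omega>" "M2 \<in> chains (n + 1) \<Omega>" "M = M1 + M2"
    "l1_norm M1 + l1_norm M2 = l1_norm M"
    and M1: "\<And>xs. coeff M1 xs = (if ?far A (set xs) then coeff M xs else 0)"
    and M2: "\<And>xs. coeff M2 xs = (if ?far A (set xs) then 0 else coeff M xs)"
    using split_chain[OF assms(2) Mc, where P = "?far A"] by blast
  have far1: "?far A (set xs)" if "coeff M1 xs \<noteq> 0" for xs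
    using that M1[of xs] by (simp split: if_splits)
  have far2: "?far B (set xs)" if "coeff M2 xs \<noteq> 0" for xs
    using that M2[of xs] taut_filling_simplex[OF assms, of xs] by (auto split: if_splits)
  \<comment> \<open>The defect of \<open>M1\<close> as a filling of \<open>X\<close>. Read through
    \<open>M1\<close> it is confined to the \<open>A\<close> side, read through \<open>M2\<close> to
    the \<open>B\<close> side.\<close>
  define D where "D = (\<lambda>ys. bd \<Omega> (coeff M1) ys - coeff X ys)"
  have D2: "D ys = coeff Y ys - bd \<Omega> (coeff M2) ys" for ys
  proof -
    have "bd \<Omega> (coeff M) ys = bd \<Omega> (coeff M1) ys + bd \<Omega> (coeff M2) ys"
      by (simp add: bd_def M12(3) lookup_add sum.distrib)
    then show ?thesis by (simp add: D_def Mb lookup_add)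
  qed
  have XA: "X \<in> chains n A" and YB: "Y \<in> chains n B" using X Y by (auto simp: cycles_def)
  \<comment> \<open>The condition passes to faces, so the boundaries of \<open>M1\<close> and
    \<open>M2\<close> inherit it.\<close>
  have far_mono: "?far S s" if "?far S t" "s \<subseteq> t" "finite t" for S s t
  proof -
    have "card (s - S) \<le> card (t - S)" using that(2,3) by (intro card_mono) auto
    then show ?thesis using that(1,2) order_trans by blast
  qed
  have bd_nz: "\<exists>v. F (v # ys) \<noteq> 0" if "bd \<Omega> F ys \<noteq> 0" for F ys
    using that unfolding bd_def by (meson sum.neutral)
  have DA: "?far A (set ys)" if "D ys \<noteq> 0" for ys
  proof (cases "coeff X ys = 0")
    case True
    then have "bd \<Omega> (coeff M1) ys \<noteq> 0" using that by (simp add: D_def)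
    then obtain v where "coeff M1 (v # ys) \<noteq> 0" using bd_nz by blast
    then show ?thesis by (intro far_mono[OF far1]) auto
  qed (use chains_set[OF XA] in blast)
  have DB: "?far B (set ys)" if "D ys \<noteq> 0" for ys
  proof (cases "coeff Y ys = 0")
    case True
    then have "bd \<Omega> (coeff M2) ys \<noteq> 0" using that by (simp add: D2)
    then obtain v where "coeff M2 (v # ys) \<noteq> 0" using bd_nz by blast
    then show ?thesis by (intro far_mono[OF far2]) auto
  qed (use chains_set[OF YB] in blast)
  have Dlen: "length ys = n + 1" if "D ys \<noteq> 0" for ys
  proof (cases "coeff X ys = 0")
    case True
    then have "bd \<Omega> (coeff M1) ys \<noteq> 0" using that by (simp add: D_def)
    then obtain v where "coeff M1 (v # ys) \<noteq> 0" using bd_nz by blast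
    from chains_length[OF M12(1) this] show ?thesis by simp
  qed (use chains_length[OF XA] in blast)
  have altD: "alternating D"
    unfolding D_def
    by (intro alternating_diff alternating_bd chains_alternating[OF M12(1)] chains_alternating[OF XA])
  have "D ys = 0" for ys
  proof (rule cycle_few_vertices[OF assms(2) _ C altD])
    show "A \<inter> B \<subseteq> \<Omega>" using assms(3) by blast
    show "length xs = n + 1 \<and> set xs \<subseteq> A \<inter> B" if nz: "D xs \<noteq> 0" for xs
    proof -
      have "distinct xs" using alternating_not_distinct[OF altD] nz by blast
      then have "card (set xs) = n + 1" using Dlen[OF nz] by (simp add: distinct_card)
      then have parts: "n + 1 \<le> card (set xs - A) + card (set xs - B) + card (set xs \<inter> (A \<inter> B))"
        using card_le_three_parts[of "set xs" A B] by simp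
      have "card (set xs - S) \<le> 1" if "?far S (set xs)" for S
        using that
      proof
        assume "set xs \<subseteq> S"
        then have "set xs - S = {}" by blast
        then show ?thesis by (simp only: card.empty zero_le)
      qed blast
      \<comment> \<open>At most two of the \<open>n + 1\<close> vertices lie outside
        \<open>A\<close> or outside \<open>B\<close>, so \<open>n \<ge> 2\<close> leaves one in
        \<open>A \<inter> B\<close>. This rules out the disjoint alternatives and puts the simplex
        in both sets.\<close>
      from this[OF DA[OF nz]] this[OF DB[OF nz]] parts
      have "card (set xs \<inter> (A \<inter> B)) \<noteq> 0" using n by linarith
      then have "set xs \<inter> (A \<inter> B) \<noteq> {}" by (metis card.empty)
      then show ?thesis using DA[OF nz] DB[OF nz] Dlen[OF nz] by blast
    qed
    show "bd \<Omega> D ys = 0" for ys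
      using bd_bd[OF chains_alternating[OF M12(1)]] cycles_bd(2)[OF assms(2,3) X]
      unfolding D_def bd_diff by simp
  qed
  then have bds: "bd \<Omega> (coeff M1) = coeff X" "bd \<Omega> (coeff M2) = coeff Y"
    using D2 by (auto simp: D_def fun_eq_iff)
  then have fill: "filling \<Omega> n X M1" "filling \<Omega> n Y M2"
    using M12 by (auto simp: filling_iff[OF assms(2)])
  have "l1_norm M = Zvol \<Omega> n X + Zvol \<Omega> n Y"
    using M Zvol_add[OF _ assms(2-7)] n by (simp add: taut_filling_def)
  \<comment> \<open>The two norms add up to the sum of the volumes and neither is below its own
    volume, so both are equal to it.\<close>
  then have "taut_filling \<Omega> n X M1" "taut_filling \<Omega> n Y M2"
    using Zvol_le[OF fill(1)] Zvol_le[OF fill(2)] M12(4) fill by (auto simp: taut_filling_def)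
  then show ?thesis using M12(3) by blast
qed

theorem theorem1:
  fixes n :: nat and A B \<Omega> :: "'a set" and X Y :: "'a list \<Rightarrow>\<^sub>0 int"
  assumes "n \<ge> 1"
    and "finite A" and "finite B" and "card (A \<inter> B) \<le> n + 1"
    and "finite \<Omega>" and "A \<union> B \<subseteq> \<Omega>"
    and "X \<in> cycles n A" and "Y \<in> cycles n B"
  shows "Zvol \<Omega> n (X + Y) = Zvol \<Omega> n X + Zvol \<Omega> n Y \<and>
    (n \<ge> 2 \<longrightarrow>
      (\<forall>M. taut_filling \<Omega> n (X + Y) M \<longrightarrow>
        (\<exists>MX MY. taut_filling \<Omega> n X MX \<and> taut_filling \<Omega> n Y MY \<and> M = MX + MY)))"
proof -
  have "A \<subseteq> \<Omega>" "B \<subseteq> \<Omega>" using assms(6) by auto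
  then show ?thesis
    using Zvol_add[OF assms(1,5) _ _ assms(4,7,8)] taut_filling_decompose[OF _ assms(5) _ _ assms(4,7,8)]
    by blast
qed

end
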